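(* Let $G$ be a multiplicative abelian group such that $g^2=1$ for all $g\in G$, let $\mathcal R=\mathbb Z[G]$, and let $f:M\to N$ be a homomorphism of $\mathcal R[\frac12]$-modules. For any $\chi\in\widehat G$, let $f_\chi:M_{(\chi)}\to N_{(\chi)}$ be the homomorphism induced by $f$. Then: (1) $f$ is injective if and only if $f_\chi$ is injective for all $\chi\in\widehat G$. (2) $f$ is surjective if and only if $f_\chi$ is surjective for all $\chi\in\widehat G$. (3) $f$ is an isomorphism if and only if $f_\chi$ is an isomorphism for all $\chi\in\widehat G$.
   Context: $\mathcal R[\frac12]=\mathbb Z[\frac12][G]$; $\widehat G=\mathrm{Hom}(G,\mu_2)$ with $\mu_2=\{\pm1\}$. For $\chi\in\widehat G$, $\mathcal R^{(\chi)}$ is the ideal of $\mathcal R$ generated by $\{g-\chi(g):g\in G\}$. For an $\mathcal R$-module $M$, $M^{(\chi)}=\mathcal R^{(\chi)}M$ and $M_{(\chi)}=M/M^{(\chi)}$. *)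

theory Defs
  imports "HOL-Algebra.Algebra" "HOL-Library.Poly_Mapping"
begin

section \<open>Group rings\<close>

text \<open>
  The group ring \<open>A[G]\<close> of a group \<open>G\<close> over a subring \<open>A\<close> of the type \<open>'k\<close>. Its elements are
  formal linear combinations, with \<open>single g c\<close> standing for \<open>c \<cdot> g\<close>. The type-class
  multiplication of \<^theory>\<open>HOL-Library.Poly_Mapping\<close> is not used, as it convolves along an
  additive structure on the type of the indices.
\<close>

definition group_ring ::
    "'k::comm_ring_1 set \<Rightarrow> ('g, 'b) monoid_scheme \<Rightarrow> ('g \<Rightarrow>\<^sub>0 'k) ring" where
  "group_ring A G =
    \<lparr>carrier = {p. Poly_Mapping.keys p \<subseteq> carrier G \<and> (\<forall>g. Poly_Mapping.lookup p g \<in> A)},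
     monoid.mult = (\<lambda>p q. \<Sum>x\<in>Poly_Mapping.keys p. \<Sum>y\<in>Poly_Mapping.keys q.
               Poly_Mapping.single (x \<otimes>\<^bsub>G\<^esub> y) (Poly_Mapping.lookup p x * Poly_Mapping.lookup q y)),
     one = Poly_Mapping.single \<one>\<^bsub>G\<^esub> 1,
     ring.zero = 0,
     add = (+)\<rparr>"

definition Z_half :: "rat set" where
  "Z_half = {of_int a / 2 ^ n | (a::int) (n::nat). True}"

text \<open>
  Taking the integers as a subset of \<^typ>\<open>rat\<close> makes \<open>\<int>[G]\<close> a subring of \<open>\<int>[1/2][G]\<close>, so that
  an \<open>\<int>[1/2][G]\<close>-module is a \<open>\<int>[G]\<close>-module with the same scalar multiplication.
\<close>

definition ZG :: "('g, 'b) monoid_scheme \<Rightarrow> ('g \<Rightarrow>\<^sub>0 rat) ring" where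
  "ZG G = group_ring \<int> G"

definition ZG_half :: "('g, 'b) monoid_scheme \<Rightarrow> ('g \<Rightarrow>\<^sub>0 rat) ring" where
  "ZG_half G = group_ring Z_half G"

section \<open>Module homomorphisms and quotient modules\<close>

definition mod_hom ::
    "('r, 'c) ring_scheme \<Rightarrow> ('r, 'm, 'd) module_scheme \<Rightarrow> ('r, 'n, 'e) module_scheme
      \<Rightarrow> ('m \<Rightarrow> 'n) set" where
  "mod_hom R M N =
    {f \<in> hom (add_monoid M) (add_monoid N).
       \<forall>a\<in>carrier R. \<forall>x\<in>carrier M. f (a \<odot>\<^bsub>M\<^esub> x) = a \<odot>\<^bsub>N\<^esub> f x}"

definition mod_iso ::
    "('r, 'c) ring_scheme \<Rightarrow> ('r, 'm, 'd) module_scheme \<Rightarrow> ('r, 'n, 'e) module_scheme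
      \<Rightarrow> ('m \<Rightarrow> 'n) set" where
  "mod_iso R M N = {f \<in> mod_hom R M N. bij_betw f (carrier M) (carrier N)}"

text \<open>
  \<open>I M\<close>: finite sums of products \<open>r \<odot> x\<close> and their negatives; for an ideal \<open>I\<close> the negatives are
  again such sums.
\<close>

definition ideal_smult :: "'r set \<Rightarrow> ('r, 'm, 'd) module_scheme \<Rightarrow> 'm set" where
  "ideal_smult I M = generate (add_monoid M) {r \<odot>\<^bsub>M\<^esub> x | r x. r \<in> I \<and> x \<in> carrier M}"

text \<open>
  The fields \<^const>\<open>monoid.mult\<close> and \<^const>\<open>one\<close> of a module record play no role in the locale
  \<^locale>\<open>module\<close> and are left unspecified.
\<close>

definition quot_module ::
    "('r, 'm, 'd) module_scheme \<Rightarrow> 'm set \<Rightarrow> ('r, 'm set) module" where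
  "quot_module M H =
    \<lparr>carrier = a_rcosets\<^bsub>M\<^esub> H,
     monoid.mult = undefined,
     one = undefined,
     ring.zero = H,
     add = set_add M,
     smult = (\<lambda>a C. \<Union>x\<in>C. H +>\<^bsub>M\<^esub> (a \<odot>\<^bsub>M\<^esub> x))\<rparr>"

definition quot_map ::
    "('r, 'n, 'e) module_scheme \<Rightarrow> 'n set \<Rightarrow> ('m \<Rightarrow> 'n) \<Rightarrow> 'm set \<Rightarrow> 'n set" where
  "quot_map N K f C = (\<Union>x\<in>C. K +>\<^bsub>N\<^esub> f x)"

section \<open>Characters\<close>

text \<open>
  The group \<open>\<mu>\<^sub>2\<close> is \<^const>\<open>sign_img\<close>. Elements of \<open>hom G sign_img\<close> are unconstrained outside
  \<open>carrier G\<close>; only the values on \<open>carrier G\<close> enter below.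
\<close>

definition char_ideal :: "('g, 'b) monoid_scheme \<Rightarrow> ('g \<Rightarrow> int) \<Rightarrow> ('g \<Rightarrow>\<^sub>0 rat) set" where
  "char_ideal G \<chi> =
    Idl\<^bsub>ZG G\<^esub> {Poly_Mapping.single g 1 - Poly_Mapping.single \<one>\<^bsub>G\<^esub> (of_int (\<chi> g)) | g.
                 g \<in> carrier G}"

definition char_sub ::
    "('g, 'b) monoid_scheme \<Rightarrow> ('g \<Rightarrow> int) \<Rightarrow> ('g \<Rightarrow>\<^sub>0 rat, 'm, 'd) module_scheme \<Rightarrow> 'm set" where
  "char_sub G \<chi> M = ideal_smult (char_ideal G \<chi>) M"

definition char_quot ::
    "('g, 'b) monoid_scheme \<Rightarrow> ('g \<Rightarrow> int) \<Rightarrow> ('g \<Rightarrow>\<^sub>0 rat, 'm, 'd) module_scheme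
      \<Rightarrow> ('g \<Rightarrow>\<^sub>0 rat, 'm set) module" where
  "char_quot G \<chi> M = quot_module M (char_sub G \<chi> M)"

definition char_map ::
    "('g, 'b) monoid_scheme \<Rightarrow> ('g \<Rightarrow> int) \<Rightarrow> ('g \<Rightarrow>\<^sub>0 rat, 'n, 'e) module_scheme
      \<Rightarrow> ('m \<Rightarrow> 'n) \<Rightarrow> 'm set \<Rightarrow> 'n set" where
  "char_map G \<chi> N f = quot_map N (char_sub G \<chi> N) f"

section \<open>Well-definedness\<close>


context
  fixes A :: "'k::comm_ring_1 set" and G :: "('g, 'b) monoid_scheme"
begin

private abbreviation cv where "cv \<equiv> monoid.mult (group_ring A G)"

private lemma cv_eq:
  assumes "finite S" "finite T" "Poly_Mapping.keys p \<subseteq> S" "Poly_Mapping.keys q \<subseteq> T"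
  shows "cv p q = (\<Sum>x\<in>S. \<Sum>y\<in>T. Poly_Mapping.single (x \<otimes>\<^bsub>G\<^esub> y)
           (Poly_Mapping.lookup p x * Poly_Mapping.lookup q y))"
proof -
  have "cv p q = (\<Sum>x\<in>Poly_Mapping.keys p. \<Sum>y\<in>T. Poly_Mapping.single (x \<otimes>\<^bsub>G\<^esub> y)
           (Poly_Mapping.lookup p x * Poly_Mapping.lookup q y))"
    unfolding group_ring_def monoid.simps ring.simps
    by (intro sum.cong refl sum.mono_neutral_left assms) (auto simp: in_keys_iff)
  also have "\<dots> = (\<Sum>x\<in>S. \<Sum>y\<in>T. Poly_Mapping.single (x \<otimes>\<^bsub>G\<^esub> y)
           (Poly_Mapping.lookup p x * Poly_Mapping.lookup q y))"
    by (intro sum.mono_neutral_left assms) (auto simp: in_keys_iff)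
  finally show ?thesis .
qed

private lemma cv_add_left: "cv (p + p') q = cv p q + cv p' q"
proof -
  let ?S = "Poly_Mapping.keys p \<union> Poly_Mapping.keys p'" and ?T = "Poly_Mapping.keys q"
  have k: "Poly_Mapping.keys (p + p') \<subseteq> ?S" by (rule Poly_Mapping.keys_add)
  show ?thesis
    using k by (simp add: cv_eq[of ?S ?T] lookup_add distrib_right Poly_Mapping.single_add sum.distrib)
qed

private lemma cv_add_right: "cv p (q + q') = cv p q + cv p q'"
proof -
  let ?T = "Poly_Mapping.keys q \<union> Poly_Mapping.keys q'" and ?S = "Poly_Mapping.keys p"
  have k: "Poly_Mapping.keys (q + q') \<subseteq> ?T" by (rule Poly_Mapping.keys_add)
  show ?thesis
    using k by (simp add: cv_eq[of ?S ?T] lookup_add distrib_left Poly_Mapping.single_add sum.distrib)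
qed

private lemma cv_zero: "cv 0 q = 0" "cv p 0 = 0"
  by (simp_all add: group_ring_def)

private lemma cv_sum_left: "cv (\<Sum>i\<in>I. h i) q = (\<Sum>i\<in>I. cv (h i) q)"
  by (induction I rule: infinite_finite_induct) (auto simp: cv_zero cv_add_left)

private lemma cv_sum_right: "cv p (\<Sum>i\<in>I. h i) = (\<Sum>i\<in>I. cv p (h i))"
  by (induction I rule: infinite_finite_induct) (auto simp: cv_zero cv_add_right)

private lemma cv_single: "cv (Poly_Mapping.single x a) (Poly_Mapping.single y b)
    = Poly_Mapping.single (x \<otimes>\<^bsub>G\<^esub> y) (a * b)"
  by (subst cv_eq[of "{x}" "{y}"]) auto

private lemma expand: "p = (\<Sum>x\<in>Poly_Mapping.keys p. Poly_Mapping.single x (Poly_Mapping.lookup p x))"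
  by (rule poly_mapping_eqI)
     (simp add: lookup_sum lookup_single when_def in_keys_iff)

lemma cring_group_ring:
  assumes "comm_group G" and "0 \<in> A" "1 \<in> A"
    and add: "\<And>a b. a \<in> A \<Longrightarrow> b \<in> A \<Longrightarrow> a + b \<in> A"
    and neg: "\<And>a. a \<in> A \<Longrightarrow> - a \<in> A"
    and mul: "\<And>a b. a \<in> A \<Longrightarrow> b \<in> A \<Longrightarrow> a * b \<in> A"
  shows "cring (group_ring A G)"
proof -
  interpret G: comm_group G by fact
  let ?R = "group_ring A G"
  have c: "p \<in> carrier ?R \<longleftrightarrow> Poly_Mapping.keys p \<subseteq> carrier G \<and> (\<forall>g. Poly_Mapping.lookup p g \<in> A)" for p
    by (simp add: group_ring_def)
  have [simp]: "\<one>\<^bsub>?R\<^esub> = Poly_Mapping.single \<one>\<^bsub>G\<^esub> 1" "\<zero>\<^bsub>?R\<^esub> = 0" "add ?R = (+)"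
    by (simp_all add: group_ring_def)
  have cs: "Poly_Mapping.single x a \<in> carrier ?R" if "x \<in> carrier G" "a \<in> A" for x a
    using that assms(2) by (auto simp: c lookup_single when_def)
  have c0: "0 \<in> carrier ?R" using assms(2) by (simp add: c)
  have ca: "p + q \<in> carrier ?R" if "p \<in> carrier ?R" "q \<in> carrier ?R" for p q
    using that add Poly_Mapping.keys_add[of p q] by (auto simp: c lookup_add)
  have csum: "(\<Sum>i\<in>I. h i) \<in> carrier ?R" if "\<And>i. i \<in> I \<Longrightarrow> h i \<in> carrier ?R" for I :: "'g set" and h
    using that by (induction I rule: infinite_finite_induct) (auto simp: c0 ca)
  have cm: "cv p q \<in> carrier ?R" if "p \<in> carrier ?R" "q \<in> carrier ?R" for p q
    using that by (subst cv_eq[OF finite_keys finite_keys subset_refl subset_refl])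
      (intro csum cs; auto simp: c intro: mul)
  have comm: "cv p q = cv q p" if "p \<in> carrier ?R" "q \<in> carrier ?R" for p q
    apply (subst (1 2) cv_eq[OF finite_keys finite_keys subset_refl subset_refl])
    apply (subst sum.swap)
    using that by (intro sum.cong refl) (auto simp: c mult.commute intro!: arg_cong2[where f=Poly_Mapping.single] G.m_comm)
  have assoc: "cv (cv p q) r = cv p (cv q r)"
    if "p \<in> carrier ?R" "q \<in> carrier ?R" "r \<in> carrier ?R" for p q r
  proof -
    have k: "Poly_Mapping.keys p \<subseteq> carrier G" "Poly_Mapping.keys q \<subseteq> carrier G"
      "Poly_Mapping.keys r \<subseteq> carrier G" using that by (auto simp: c)
    show ?thesis
      apply (subst (1 2) expand[of p], subst (1 2) expand[of q], subst (1 2) expand[of r])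
      apply (simp only: cv_sum_left cv_sum_right cv_single)
      apply (intro sum.cong refl)
      using k apply (auto simp: mult.assoc intro!: arg_cong2[where f=Poly_Mapping.single] G.m_assoc)
      done
  qed
  have one: "cv (Poly_Mapping.single \<one>\<^bsub>G\<^esub> 1) p = p" if "p \<in> carrier ?R" for p
  proof -
    have k: "Poly_Mapping.keys p \<subseteq> carrier G" using that by (simp add: c)
    have "cv (Poly_Mapping.single \<one>\<^bsub>G\<^esub> 1) p = (\<Sum>x\<in>Poly_Mapping.keys p. Poly_Mapping.single x (Poly_Mapping.lookup p x))"
      apply (subst expand[of p])
      apply (simp only: cv_sum_right cv_single)
      using k by (intro sum.cong refl) auto
    then show ?thesis using expand[of p] by simp
  qed
  show ?thesis
  proof (rule cringI)
    show "abelian_group ?R"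
      by (rule abelian_groupI)
         (use ca c0 in \<open>auto simp: add_ac intro!: bexI[of _ "- _"]\<close>, simp add: c neg)
    show "comm_monoid ?R"
      by (rule comm_monoidI) (use cm comm assoc one cs assms(3) in auto)
  qed (simp_all add: cv_add_left)
qed

end

lemma cring_ZG: "comm_group G \<Longrightarrow> cring (ZG G)"
  unfolding ZG_def by (rule cring_group_ring) auto

lemma cring_ZG_half:
  assumes "comm_group G" shows "cring (ZG_half G)"
  unfolding ZG_half_def
proof (rule cring_group_ring[OF assms])
  have I: "of_int a / 2 ^ n \<in> Z_half" for a n unfolding Z_half_def by blast
  show "0 \<in> Z_half" "1 \<in> Z_half" using I[of 0 0] I[of 1 0] by simp_all
  fix x y assume "x \<in> Z_half" "y \<in> Z_half"
  then obtain a m b n where x: "x = of_int a / 2 ^ m" and y: "y = of_int b / 2 ^ n"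
    unfolding Z_half_def by blast
  show "x + y \<in> Z_half"
    using I[of "a * 2 ^ n + b * 2 ^ m" "m + n"] by (simp add: x y field_simps power_add)
  show "x * y \<in> Z_half" using I[of "a * b" "m + n"] by (simp add: x y power_add)
  show "- x \<in> Z_half" using I[of "- a" m] by (simp add: x)
qed


lemma quot_module_props:
  assumes M: "module R M" and H: "submodule H R M"
  shows "module R (quot_module M H)"
    and "x \<in> carrier M \<Longrightarrow> H +>\<^bsub>M\<^esub> x \<in> carrier (quot_module M H)"
    and "a \<in> carrier R \<Longrightarrow> x \<in> carrier M \<Longrightarrow>
           a \<odot>\<^bsub>quot_module M H\<^esub> (H +>\<^bsub>M\<^esub> x) = H +>\<^bsub>M\<^esub> (a \<odot>\<^bsub>M\<^esub> x)"
proof -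
  interpret M: module R M by (fact M)
  interpret H: submodule H R M by (fact H)
  interpret A: abelian_subgroup H M
    by (intro abelian_subgroupI3 additive_subgroup.intro H.subgroup_axioms M.abelian_group_axioms)
  let ?Q = "quot_module M H"
  have car: "carrier ?Q = {H +>\<^bsub>M\<^esub> x | x. x \<in> carrier M}"
    by (auto simp: quot_module_def A_RCOSETS_def')
  have add: "(H +>\<^bsub>M\<^esub> x) \<oplus>\<^bsub>?Q\<^esub> (H +>\<^bsub>M\<^esub> y) = H +>\<^bsub>M\<^esub> (x \<oplus>\<^bsub>M\<^esub> y)"
    if "x \<in> carrier M" "y \<in> carrier M" for x y
    using that by (simp add: quot_module_def A.a_rcos_sum)
  have sm: "a \<odot>\<^bsub>?Q\<^esub> (H +>\<^bsub>M\<^esub> x) = H +>\<^bsub>M\<^esub> (a \<odot>\<^bsub>M\<^esub> x)"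
    if a: "a \<in> carrier R" and x: "x \<in> carrier M" for a x
  proof -
    have "H +>\<^bsub>M\<^esub> (a \<odot>\<^bsub>M\<^esub> y) = H +>\<^bsub>M\<^esub> (a \<odot>\<^bsub>M\<^esub> x)" if "y \<in> H +>\<^bsub>M\<^esub> x" for y
    proof -
      obtain h where h: "h \<in> H" "y = h \<oplus>\<^bsub>M\<^esub> x" using \<open>y \<in> H +>\<^bsub>M\<^esub> x\<close> by (auto simp: a_r_coset_def')
      have "h \<in> carrier M" using h H.subset by auto
      then have "a \<odot>\<^bsub>M\<^esub> y = (a \<odot>\<^bsub>M\<^esub> h) \<oplus>\<^bsub>M\<^esub> (a \<odot>\<^bsub>M\<^esub> x)"
        using a x h by (simp add: M.smult_r_distr)
      then have "a \<odot>\<^bsub>M\<^esub> y \<in> H +>\<^bsub>M\<^esub> (a \<odot>\<^bsub>M\<^esub> x)"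
        using H.smult_closed[OF a h(1)] by (auto simp: a_r_coset_def')
      then show ?thesis using A.a_repr_independence' a x by (metis M.smult_closed)
    qed
    moreover have "x \<in> H +>\<^bsub>M\<^esub> x" using A.a_rcos_self x by blast
    ultimately have "(\<Union>y\<in>H +>\<^bsub>M\<^esub> x. H +>\<^bsub>M\<^esub> (a \<odot>\<^bsub>M\<^esub> y)) = H +>\<^bsub>M\<^esub> (a \<odot>\<^bsub>M\<^esub> x)" by blast
    then show ?thesis unfolding quot_module_def by simp
  qed
  show "x \<in> carrier M \<Longrightarrow> H +>\<^bsub>M\<^esub> x \<in> carrier ?Q" by (auto simp: car)
  show "a \<in> carrier R \<Longrightarrow> x \<in> carrier M \<Longrightarrow> a \<odot>\<^bsub>?Q\<^esub> (H +>\<^bsub>M\<^esub> x) = H +>\<^bsub>M\<^esub> (a \<odot>\<^bsub>M\<^esub> x)" by (fact sm)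
  have zero: "\<zero>\<^bsub>?Q\<^esub> = H +>\<^bsub>M\<^esub> \<zero>\<^bsub>M\<^esub>"
    using A.a_subset by (simp add: quot_module_def)
  have in_car: "H +>\<^bsub>M\<^esub> x \<in> carrier ?Q" if "x \<in> carrier M" for x
    using that by (auto simp: car)
  have rep: "\<exists>x\<in>carrier M. C = H +>\<^bsub>M\<^esub> x" if "C \<in> carrier ?Q" for C
    using that by (auto simp: car)
  have ab: "abelian_group ?Q"
  proof (rule abelian_groupI)
    fix C assume "C \<in> carrier ?Q"
    then obtain x where x: "x \<in> carrier M" "C = H +>\<^bsub>M\<^esub> x" using rep by blast
    then have "(H +>\<^bsub>M\<^esub> (\<ominus>\<^bsub>M\<^esub> x)) \<oplus>\<^bsub>?Q\<^esub> C = \<zero>\<^bsub>?Q\<^esub>"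
      by (simp add: add zero M.l_neg)
    then show "\<exists>D\<in>carrier ?Q. D \<oplus>\<^bsub>?Q\<^esub> C = \<zero>\<^bsub>?Q\<^esub>" using in_car x by blast
  qed (auto dest!: rep simp: in_car add zero M.a_ac)
  show "module R ?Q"
    by (rule moduleI[OF M.R.is_cring ab])
       (auto dest!: rep simp: in_car sm add M.smult_l_distr M.smult_r_distr M.smult_assoc1)
qed

context
  fixes G :: "('g, 'b) monoid_scheme" and \<chi> :: "'g \<Rightarrow> int"
  assumes G: "comm_group G"
begin

lemma ZG_subset_ZG_half: "carrier (ZG G) \<subseteq> carrier (ZG_half G)"
proof -
  have "x \<in> Z_half" if "x \<in> \<int>" for x
    using that unfolding Z_half_def by (metis (mono_tags, lifting) Ints_cases div_by_1 mem_Collect_eq power_0)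
  then show ?thesis by (auto simp: ZG_def ZG_half_def group_ring_def)
qed

lemma ideal_char_ideal: "ideal (char_ideal G \<chi>) (ZG G)"
proof -
  interpret cring "ZG G" by (rule cring_ZG[OF G])
  interpret G: comm_group G by (fact G)
  have [simp]: "carrier (ZG G) = {p. Poly_Mapping.keys p \<subseteq> carrier G \<and> (\<forall>g. Poly_Mapping.lookup p g \<in> \<int>)}"
    by (simp add: ZG_def group_ring_def)
  have "Poly_Mapping.single g 1 - Poly_Mapping.single \<one>\<^bsub>G\<^esub> (of_int (\<chi> g)) \<in> carrier (ZG G)"
    if "g \<in> carrier G" for g
    using that keys_diff[of "Poly_Mapping.single g (1::rat)" "Poly_Mapping.single \<one>\<^bsub>G\<^esub> (of_int (\<chi> g))"]
    by (auto simp: lookup_minus lookup_single when_def split: if_splits)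
  then show ?thesis unfolding char_ideal_def by (intro genideal_ideal) blast
qed

lemma char_ideal_subset: "char_ideal G \<chi> \<subseteq> carrier (ZG_half G)"
  using ideal.Icarr[OF ideal_char_ideal] ZG_subset_ZG_half by blast

lemma submodule_char_sub:
  assumes M: "module (ZG_half G) M"
  shows "submodule (char_sub G \<chi> M) (ZG_half G) M"
proof -
  interpret M: module "ZG_half G" M by (fact M)
  let ?S = "{r \<odot>\<^bsub>M\<^esub> x | r x. r \<in> char_ideal G \<chi> \<and> x \<in> carrier M}"
  have S: "?S \<subseteq> carrier M" using char_ideal_subset by auto
  have sub: "subgroup (char_sub G \<chi> M) (add_monoid M)"
    unfolding char_sub_def ideal_smult_def by (rule M.add.generate_is_subgroup[OF S])
  have "a \<odot>\<^bsub>M\<^esub> y \<in> char_sub G \<chi> M" if a: "a \<in> carrier (ZG_half G)" and y: "y \<in> char_sub G \<chi> M" for a y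
  proof -
    have in_S: "a \<odot>\<^bsub>M\<^esub> h \<in> ?S" if "h \<in> ?S" for h
    proof -
      obtain r x where h: "h = r \<odot>\<^bsub>M\<^esub> x" "r \<in> char_ideal G \<chi>" "x \<in> carrier M" using \<open>h \<in> ?S\<close> by blast
      have r: "r \<in> carrier (ZG_half G)" using h char_ideal_subset by auto
      have "a \<odot>\<^bsub>M\<^esub> h = r \<odot>\<^bsub>M\<^esub> (a \<odot>\<^bsub>M\<^esub> x)"
        unfolding h(1) using r a h(3) by (metis M.smult_assoc1 M.R.m_comm)
      then show ?thesis using h a by blast
    qed
    show ?thesis using y[unfolded char_sub_def ideal_smult_def]
    proof (induction rule: generate.induct)
      case one
      show ?case using a sub subgroup.one_closed by fastforce
    next
      case (incl h)
      then show ?case unfolding char_sub_def ideal_smult_def by (intro generate.incl in_S)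
    next
      case (inv h)
      have "h \<in> carrier M" using inv S by auto
      then have "a \<odot>\<^bsub>M\<^esub> inv\<^bsub>add_monoid M\<^esub> h = inv\<^bsub>add_monoid M\<^esub> (a \<odot>\<^bsub>M\<^esub> h)"
        using M.smult_r_minus[OF a] by (simp add: a_inv_def)
      then show ?case unfolding char_sub_def ideal_smult_def using in_S[OF inv] by (auto intro: generate.inv)
    next
      case (eng h k)
      have "h \<in> carrier M" "k \<in> carrier M"
        using eng M.add.generate_in_carrier[OF S] by auto
      then show ?case using eng.IH a sub subgroup.m_closed[OF sub] by (simp add: M.smult_r_distr)
    qed
  qed
  then show ?thesis using sub by (intro submodule.intro submodule_axioms.intro) auto
qed

lemma module_char_quot:
  "module (ZG_half G) M \<Longrightarrow> module (ZG_half G) (char_quot G \<chi> M)"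
  unfolding char_quot_def by (intro quot_module_props(1) submodule_char_sub)

lemma char_map_coset:
  assumes M: "module (ZG_half G) M" and N: "module (ZG_half G) N"
    and f: "f \<in> mod_hom (ZG_half G) M N" and x: "x \<in> carrier M"
  shows "char_map G \<chi> N f (char_sub G \<chi> M +>\<^bsub>M\<^esub> x) = char_sub G \<chi> N +>\<^bsub>N\<^esub> f x"
proof -
  interpret M: module "ZG_half G" M by (fact M)
  interpret N: module "ZG_half G" N by (fact N)
  interpret HM: submodule "char_sub G \<chi> M" "ZG_half G" M by (rule submodule_char_sub[OF M])
  interpret HN: submodule "char_sub G \<chi> N" "ZG_half G" N by (rule submodule_char_sub[OF N])
  interpret AM: abelian_subgroup "char_sub G \<chi> M" M
    by (intro abelian_subgroupI3 additive_subgroup.intro HM.subgroup_axioms M.abelian_group_axioms)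
  interpret AN: abelian_subgroup "char_sub G \<chi> N" N
    by (intro abelian_subgroupI3 additive_subgroup.intro HN.subgroup_axioms N.abelian_group_axioms)
  have fc: "f y \<in> carrier N" if "y \<in> carrier M" for y
    using f that by (auto simp: mod_hom_def hom_def)
  have fa: "f (y \<oplus>\<^bsub>M\<^esub> z) = f y \<oplus>\<^bsub>N\<^esub> f z" if "y \<in> carrier M" "z \<in> carrier M" for y z
    using f that by (auto simp: mod_hom_def hom_def)
  have fs: "f (a \<odot>\<^bsub>M\<^esub> y) = a \<odot>\<^bsub>N\<^esub> f y" if "a \<in> carrier (ZG_half G)" "y \<in> carrier M" for a y
    using f that by (auto simp: mod_hom_def)
  have gh: "group_hom (add_monoid M) (add_monoid N) f"
    using f by (intro group_hom.intro group_hom_axioms.intro M.a_group N.a_group) (simp add: mod_hom_def)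
  let ?S = "{r \<odot>\<^bsub>M\<^esub> x | r x. r \<in> char_ideal G \<chi> \<and> x \<in> carrier M}"
  let ?T = "{r \<odot>\<^bsub>N\<^esub> x | r x. r \<in> char_ideal G \<chi> \<and> x \<in> carrier N}"
  have S: "?S \<subseteq> carrier (add_monoid M)" using char_ideal_subset by auto
  have "f z \<in> ?T" if z: "z \<in> ?S" for z
  proof -
    obtain r y where ry: "z = r \<odot>\<^bsub>M\<^esub> y" "r \<in> char_ideal G \<chi>" "y \<in> carrier M" using z by blast
    have "f z = r \<odot>\<^bsub>N\<^esub> f y" unfolding ry(1) using ry char_ideal_subset by (intro fs) auto
    then show ?thesis using ry(2) fc[OF ry(3)] by blast
  qed
  then have "f ` ?S \<subseteq> ?T" by blast
  then have fH: "f ` char_sub G \<chi> M \<subseteq> char_sub G \<chi> N"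
    unfolding char_sub_def ideal_smult_def group_hom.generate_img[OF gh S, symmetric]
    by (rule N.add.mono_generate)
  have "char_sub G \<chi> N +>\<^bsub>N\<^esub> f y = char_sub G \<chi> N +>\<^bsub>N\<^esub> f x" if y: "y \<in> char_sub G \<chi> M +>\<^bsub>M\<^esub> x" for y
  proof -
    obtain h where h: "h \<in> char_sub G \<chi> M" "y = h \<oplus>\<^bsub>M\<^esub> x" using y by (auto simp: a_r_coset_def')
    have "h \<in> carrier M" using h HM.subset by auto
    then have "f y = f h \<oplus>\<^bsub>N\<^esub> f x" using fa x h(2) by simp
    then have "f y \<in> char_sub G \<chi> N +>\<^bsub>N\<^esub> f x" using fH h(1) by (auto simp: a_r_coset_def')
    then show ?thesis using AN.a_repr_independence' fc[OF x] by metis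
  qed
  moreover have "x \<in> char_sub G \<chi> M +>\<^bsub>M\<^esub> x" using AM.a_rcos_self x by blast
  ultimately show ?thesis unfolding char_map_def quot_map_def by blast
qed

end

end

(* The functor sending M to M_(chi) is a localization, hence exact: M^(chi) consists of the elements
   killed by some finite product of the idempotents (1 + chi(g) g)/2, and each such
   product acts as the identity modulo M^(chi). This gives the passage from f to all f_chi.
   For the converse one separates an element y from a submodule K not containing it (K = 0 for
   injectivity, K = f(M) for surjectivity). By Zorn enlarge K to a submodule H maximal among those
   avoiding y; orthogonality of (1 + g)/2 and (1 - g)/2 and maximality force one of them to send y
   into H, so g y = chi(g) y mod H for a sign chi(g). This chi is a character, and no product of its
   idempotents sends y into K. *)

theory Submission
  imports Defs
begin

section \<open>Elements and operations of Z[1/2][G]\<close>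

lemma carrier_ZG_half:
  "p \<in> carrier (ZG_half G) \<longleftrightarrow>
    Poly_Mapping.keys p \<subseteq> carrier G \<and> (\<forall>g. Poly_Mapping.lookup p g \<in> Z_half)"
  by (simp add: ZG_half_def group_ring_def)

lemma ZG_half_simps [simp]:
  "\<one>\<^bsub>ZG_half G\<^esub> = Poly_Mapping.single \<one>\<^bsub>G\<^esub> 1"
  "\<zero>\<^bsub>ZG_half G\<^esub> = 0"
  "p \<oplus>\<^bsub>ZG_half G\<^esub> q = p + q"
  by (simp_all add: ZG_half_def group_ring_def)

text \<open>Both group rings use the same operations on rational coefficients and differ only in
  their carriers. Elements of \<open>ZG G\<close> can therefore be multiplied and added inside
  \<open>ZG_half G\<close>.\<close>

lemma ZG_simps:
  "p \<otimes>\<^bsub>ZG G\<^esub> q = p \<otimes>\<^bsub>ZG_half G\<^esub> q"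
  "\<zero>\<^bsub>ZG G\<^esub> = 0"
  "p \<oplus>\<^bsub>ZG G\<^esub> q = p + q"
  by (simp_all add: ZG_def ZG_half_def group_ring_def)

lemma ZG_half_mult_single [simp]:
  "Poly_Mapping.single x a \<otimes>\<^bsub>ZG_half G\<^esub> Poly_Mapping.single y b
    = Poly_Mapping.single (x \<otimes>\<^bsub>G\<^esub> y) (a * b)"
  by (simp add: ZG_half_def group_ring_def)

lemma Z_half_uminus_one [simp]: "- (1::rat) \<in> Z_half"
  unfolding Z_half_def by (rule CollectI, rule exI[of _ "-1"], rule exI[of _ 0]) simp

lemma Z_half_zero [simp]: "(0::rat) \<in> Z_half"
  unfolding Z_half_def by (rule CollectI, rule exI[of _ 0], rule exI[of _ 0]) simp

lemma Z_half_one [simp]: "(1::rat) \<in> Z_half"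
  unfolding Z_half_def by (rule CollectI, rule exI[of _ 1], rule exI[of _ 0]) simp

lemma Z_half_half: "(1/2::rat) \<in> Z_half" "- (1/2::rat) \<in> Z_half"
  unfolding Z_half_def
   apply (rule CollectI, rule exI[of _ 1], rule exI[of _ 1], simp)
  apply (rule CollectI, rule exI[of _ "-1"], rule exI[of _ 1], simp)
  done

lemma single_in_ZG_half:
  assumes "x \<in> carrier G" "a \<in> Z_half"
  shows "Poly_Mapping.single x a \<in> carrier (ZG_half G)"
  using assms by (auto simp: carrier_ZG_half lookup_single when_def)

section \<open>Cosets of submodules\<close>

lemma submodule_additive:
  assumes "module R M" "submodule H R M"
  shows "abelian_subgroup H M"
proof -
  interpret M: module R M by fact
  interpret H: submodule H R M by fact
  show ?thesis
    by (intro abelian_subgroupI3 additive_subgroup.intro H.subgroup_axioms M.abelian_group_axioms)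
qed

lemma (in abelian_subgroup) a_rcos_eq_iff:
  assumes "x \<in> carrier G" "y \<in> carrier G"
  shows "H +> x = H +> y \<longleftrightarrow> x \<ominus> y \<in> H"
  using assms a_rcos_module_imp[of y x] a_rcos_module_rev[of y x] a_repr_independence'[of x y]
    a_rcos_self[of x]
  by (metis a_subgroup minus_eq)

lemma minus_zero_right:
  assumes "abelian_group A" "x \<in> carrier A"
  shows "x \<ominus>\<^bsub>A\<^esub> \<zero>\<^bsub>A\<^esub> = x"
proof -
  interpret abelian_group A by fact
  show ?thesis using add.inv_one assms(2) by (simp add: minus_eq flip: a_inv_def)
qed

section \<open>The idempotents (1 + s g)/2\<close>

locale elementary_2_group = comm_group G for G (structure) +
  assumes square: "g \<in> carrier G \<Longrightarrow> g \<otimes> g = \<one>"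
begin

abbreviation R where "R \<equiv> ZG_half G"

lemma comm_G: "comm_group G" by unfold_locales

sublocale R: cring "ZG_half G"
  by (rule cring_ZG_half) unfold_locales

text \<open>For s = 1 or s = -1 this is the idempotent (1 + s g)/2, the projection onto the part of
  a module on which g acts as s. The sign is rational because it enters as a coefficient.\<close>

definition idem :: "'a \<Rightarrow> rat \<Rightarrow> ('a \<Rightarrow>\<^sub>0 rat)" where
  "idem g s = Poly_Mapping.single \<one> (1/2) + Poly_Mapping.single g (s/2)"

lemma sign_half: "s \<in> {-1, 1} \<Longrightarrow> s / 2 \<in> Z_half" for s :: rat
  using Z_half_half by auto

lemma sign_in_Z_half: "s \<in> {-1, 1} \<Longrightarrow> s \<in> Z_half" for s :: rat
  by auto

lemma idem_closed: "g \<in> carrier G \<Longrightarrow> s \<in> {-1, 1} \<Longrightarrow> idem g s \<in> carrier R"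
  unfolding idem_def
  using R.a_closed[OF single_in_ZG_half single_in_ZG_half] Z_half_half sign_half one_closed
  by (metis ZG_half_simps(3))

lemma idem_add: "idem g s + idem g (- s) = Poly_Mapping.single \<one> 1"
  by (simp add: idem_def single_add[symmetric] add_ac single_uminus[symmetric])

text \<open>Expands a product of two-term elements. The membership hypotheses are there because the
  ring locale provides distributivity on the carrier only.\<close>

lemma mult_single_sum:
  assumes "x \<in> carrier G" "y \<in> carrier G" "z \<in> carrier G" "w \<in> carrier G"
    and "a \<in> Z_half" "b \<in> Z_half" "c \<in> Z_half" "d \<in> Z_half"
  shows "(Poly_Mapping.single x a + Poly_Mapping.single y b)
      \<otimes>\<^bsub>R\<^esub> (Poly_Mapping.single z c + Poly_Mapping.single w d) =
    Poly_Mapping.single (x \<otimes> z) (a * c) + Poly_Mapping.single (x \<otimes> w) (a * d)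
    + (Poly_Mapping.single (y \<otimes> z) (b * c) + Poly_Mapping.single (y \<otimes> w) (b * d))"
proof -
  note s = single_in_ZG_half[of _ G]
  have "Poly_Mapping.single z c + Poly_Mapping.single w d \<in> carrier R"
    using R.a_closed[OF s[of z c] s[of w d]] assms by simp
  then show ?thesis
    using R.l_distr[OF s[of x a] s[of y b], of "Poly_Mapping.single z c + Poly_Mapping.single w d"]
      R.r_distr[OF s[of z c] s[of w d] s[of x a]] R.r_distr[OF s[of z c] s[of w d] s[of y b]] assms
    by simp
qed

text \<open>(1 - s g)(1 + s g) = 1 - s^2 g^2 = 0, because s^2 = 1 and g^2 = 1.\<close>

lemma idem_orthogonal:
  assumes "g \<in> carrier G" "s \<in> {-1, 1}"
  shows "idem g (- s) \<otimes>\<^bsub>R\<^esub> idem g s = 0"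
  unfolding idem_def
  apply (subst mult_single_sum)
  using assms sign_half[of s] sign_half[of "- s"] Z_half_half
  by (auto simp: square single_add[symmetric] single_uminus add_ac)

text \<open>(1 + s g)(g - s) = g - s + s g^2 - s^2 g = 0. Hence every generator of a character ideal
  is killed by the idempotent of its group element.\<close>

lemma idem_annihilates_generator:
  assumes "g \<in> carrier G" "s \<in> {-1, 1}"
  shows "idem g s \<otimes>\<^bsub>R\<^esub> (Poly_Mapping.single g 1 - Poly_Mapping.single \<one> s) = 0"
proof -
  \<comment> \<open>The difference becomes a sum of two terms so that \<open>mult_single_sum\<close>
    applies.\<close>
  have eq: "Poly_Mapping.single g 1 - Poly_Mapping.single \<one> s
      = Poly_Mapping.single g 1 + Poly_Mapping.single \<one> (- s)"
    by (simp add: single_uminus)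
  show ?thesis
    unfolding idem_def eq
    apply (subst mult_single_sum)
    using assms sign_half[of s] Z_half_half
    by (auto simp: square single_uminus)
qed

text \<open>(g - s)(-s/2) = (1 - s g)/2, since s^2 = 1. So the complementary idempotent is a
  multiple of g - s once 2 is invertible.\<close>

lemma idem_complement_eq:
  assumes "g \<in> carrier G" "s \<in> {-1, 1}"
  shows "idem g (- s) = (Poly_Mapping.single g 1 - Poly_Mapping.single \<one> s)
           \<otimes>\<^bsub>R\<^esub> Poly_Mapping.single \<one> (- s / 2)"
proof -
  note c = single_in_ZG_half[of _ G]
  have eq: "Poly_Mapping.single g 1 - Poly_Mapping.single \<one> s
      = Poly_Mapping.single g 1 + Poly_Mapping.single \<one> (- s)"
    by (simp add: single_uminus)
  show ?thesis
    unfolding eq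
    using R.l_distr[OF c[of g 1] c[of \<one> "-s"] c[of \<one> "-s/2"]] assms
      sign_half[of "-s"] by (auto simp: idem_def)
qed

text \<open>Half of the identity 1 - s t g h = (1 - s g) + s g (1 - t h). If g acts on y as s and h
  acts on y as t modulo a submodule, it shows that g h acts as s t; this is how a choice of signs is
  seen to be multiplicative.\<close>

lemma idem_mult:
  assumes "g \<in> carrier G" "h \<in> carrier G" "s \<in> {-1, 1}" "t \<in> {-1, 1}"
  shows "idem (g \<otimes> h) (- (s * t)) = idem g (- s) + Poly_Mapping.single g s \<otimes>\<^bsub>R\<^esub> idem h (- t)"
proof -
  note c = single_in_ZG_half[of _ G]
  have "Poly_Mapping.single g s \<otimes>\<^bsub>R\<^esub> idem h (- t)
      = Poly_Mapping.single g (s / 2) + Poly_Mapping.single (g \<otimes> h) (- (s * t) / 2)"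
    using R.r_distr[OF c[of \<one> "1/2"] c[of h "-t/2"] c[of g s]] assms
      sign_half[of "-t"] sign_in_Z_half[of s] Z_half_half
    by (auto simp: idem_def)
  then show ?thesis
    by (simp add: idem_def add_ac single_uminus)
qed

text \<open>The multiplicative set of the localization belonging to \<chi>. Since G may be infinite,
  all finite products are collected instead of one product over G.\<close>

inductive_set idem_products :: "('a \<Rightarrow> int) \<Rightarrow> ('a \<Rightarrow>\<^sub>0 rat) set" for \<chi> where
  one: "Poly_Mapping.single \<one> 1 \<in> idem_products \<chi>"
| mult: "e \<in> idem_products \<chi> \<Longrightarrow> g \<in> carrier G \<Longrightarrow>
    idem g (of_int (\<chi> g)) \<otimes>\<^bsub>R\<^esub> e \<in> idem_products \<chi>"

lemma generator_closed:
  assumes "g \<in> carrier G"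
  shows "Poly_Mapping.single g 1 - Poly_Mapping.single \<one> (of_int k) \<in> carrier (ZG G)"
  using assms keys_diff[of "Poly_Mapping.single g (1::rat)" "Poly_Mapping.single \<one> (of_int k)"]
  by (auto simp: ZG_def group_ring_def lookup_minus lookup_single when_def split: if_splits)

section \<open>Products of idempotents and the submodule M^(chi)\<close>

context
  fixes \<chi> assumes \<chi>: "\<chi> \<in> hom G sign_img"
begin

lemma char_values: "g \<in> carrier G \<Longrightarrow> of_int (\<chi> g) \<in> {-1, 1 :: rat}"
  using hom_in_carrier[OF \<chi>, of g] by (auto simp: sign_img_def)

lemma idem_products_closed: "e \<in> idem_products \<chi> \<Longrightarrow> e \<in> carrier R"
  by (induction rule: idem_products.induct)
     (use R.one_closed idem_closed char_values in \<open>auto intro!: R.m_closed\<close>)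

text \<open>Provides, for two products, a single one that kills whatever either of them
  kills.\<close>

lemma idem_products_mult:
  assumes "e \<in> idem_products \<chi>" "e' \<in> idem_products \<chi>"
  shows "e \<otimes>\<^bsub>R\<^esub> e' \<in> idem_products \<chi>"
  using assms(1)
proof induction
  case one
  then show ?case using R.l_one[OF idem_products_closed[OF assms(2)]] assms(2) by simp
next
  case (mult e g)
  then show ?case
    using R.m_assoc[OF idem_closed[OF _ char_values] idem_products_closed idem_products_closed] assms(2)
    by (simp add: idem_products.mult)
qed

text \<open>The elements of \<open>ZG G\<close> killed by some product form an ideal: for a sum one
  multiplies the two annihilators. This ideal contains the generators of \<open>char_ideal\<close>,
  hence all of it.\<close>

lemma char_ideal_annihilated:
  assumes "r \<in> char_ideal G \<chi>"
  shows "\<exists>e\<in>idem_products \<chi>. e \<otimes>\<^bsub>R\<^esub> r = 0"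
proof -
  interpret Z: cring "ZG G" by (rule cring_ZG) unfold_locales
  note ZR = subsetD[OF ZG_subset_ZG_half[OF comm_G]]
  note ec = idem_products_closed
  let ?J = "{r \<in> carrier (ZG G). \<exists>e\<in>idem_products \<chi>. e \<otimes>\<^bsub>R\<^esub> r = 0}"
  have add: "r + q \<in> ?J" if "r \<in> ?J" "q \<in> ?J" for r q
  proof -
    obtain d e where d: "d \<in> idem_products \<chi>" "d \<otimes>\<^bsub>R\<^esub> r = 0"
      and e: "e \<in> idem_products \<chi>" "e \<otimes>\<^bsub>R\<^esub> q = 0" using \<open>r \<in> ?J\<close> \<open>q \<in> ?J\<close> by blast
    have rq: "r \<in> carrier R" "q \<in> carrier R" using ZR that by auto
    have "(d \<otimes>\<^bsub>R\<^esub> e) \<otimes>\<^bsub>R\<^esub> (r \<oplus>\<^bsub>R\<^esub> q) = e \<otimes>\<^bsub>R\<^esub> (d \<otimes>\<^bsub>R\<^esub> r) \<oplus>\<^bsub>R\<^esub> d \<otimes>\<^bsub>R\<^esub> (e \<otimes>\<^bsub>R\<^esub> q)"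
      using rq ec[OF d(1)] ec[OF e(1)] by (simp add: R.m_ac R.r_distr del: ZG_half_simps)
    also have "\<dots> = 0"
      using R.r_null[OF ec[OF d(1)]] R.r_null[OF ec[OF e(1)]] d(2) e(2) by simp
    finally show ?thesis
      using idem_products_mult[OF d(1) e(1)] that Z.a_closed[of r q] by (auto simp: ZG_simps)
  qed
  have mul: "x \<otimes>\<^bsub>R\<^esub> r \<in> ?J" if "r \<in> ?J" "x \<in> carrier (ZG G)" for r x
  proof -
    obtain d where d: "d \<in> idem_products \<chi>" "d \<otimes>\<^bsub>R\<^esub> r = 0" using \<open>r \<in> ?J\<close> by blast
    have "d \<otimes>\<^bsub>R\<^esub> (x \<otimes>\<^bsub>R\<^esub> r) = x \<otimes>\<^bsub>R\<^esub> (d \<otimes>\<^bsub>R\<^esub> r)"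
      using ZR that ec[OF d(1)] by (intro R.m_lcomm) auto
    also have "\<dots> = 0" using R.r_null[of x] ZR that d(2) by simp
    finally show ?thesis using d(1) Z.m_closed[of x r] that by (auto simp: ZG_simps)
  qed
  have zero: "0 \<in> ?J"
    using Z.zero_closed idem_products.one R.r_null[OF R.one_closed] by (auto simp: ZG_simps)
  have "ideal ?J (ZG G)"
  proof (rule idealI)
    show "ring (ZG G)" by unfold_locales
    show "subgroup ?J (add_monoid (ZG G))"
    proof (rule Z.add.subgroupI)
      fix a assume a: "a \<in> ?J"
      \<comment> \<open>Negation is multiplication by -1, so \<open>mul\<close> also gives closure
        under negatives.\<close>
      have "\<ominus>\<^bsub>ZG G\<^esub> a = (\<ominus>\<^bsub>ZG G\<^esub> \<one>\<^bsub>ZG G\<^esub>) \<otimes>\<^bsub>R\<^esub> a"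
        using a Z.l_minus[of "\<one>\<^bsub>ZG G\<^esub>" a] Z.l_one[of a] by (simp add: ZG_simps)
      then show "\<ominus>\<^bsub>ZG G\<^esub> a \<in> ?J" using mul[OF a, of "\<ominus>\<^bsub>ZG G\<^esub> \<one>\<^bsub>ZG G\<^esub>"] by simp
    next
      fix a b assume "a \<in> ?J" "b \<in> ?J"
      then show "a \<oplus>\<^bsub>ZG G\<^esub> b \<in> ?J" using add by (simp add: ZG_simps)
    qed (use zero in auto)
    fix a x assume "a \<in> ?J" "x \<in> carrier (ZG G)"
    then show "x \<otimes>\<^bsub>ZG G\<^esub> a \<in> ?J" "a \<otimes>\<^bsub>ZG G\<^esub> x \<in> ?J"
      using mul[of a x] Z.m_comm[of a x] by (simp_all add: ZG_simps)
  qed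
  moreover have "Poly_Mapping.single g 1 - Poly_Mapping.single \<one> (of_int (\<chi> g)) \<in> ?J"
    if g: "g \<in> carrier G" for g
  proof -
    have "idem g (of_int (\<chi> g)) \<otimes>\<^bsub>R\<^esub> Poly_Mapping.single \<one> 1 \<in> idem_products \<chi>"
      by (intro idem_products.intros g)
    then have "idem g (of_int (\<chi> g)) \<in> idem_products \<chi>"
      using R.r_one[OF idem_closed[OF g char_values[OF g]]] by simp
    moreover have "Poly_Mapping.single g 1 - Poly_Mapping.single \<one> (of_int (\<chi> g)) \<in> carrier (ZG G)"
      by (rule generator_closed[OF g])
    ultimately show ?thesis using idem_annihilates_generator[OF g char_values[OF g]] by blast
  qed
  ultimately have "char_ideal G \<chi> \<subseteq> ?J"
    unfolding char_ideal_def by (intro Z.genideal_minimal) auto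
  then show ?thesis using assms by blast
qed

text \<open>A product that kills r kills every r x, and sums are handled by multiplying
  annihilators. This is one half of the description of M^(chi) as the elements killed by some
  product.\<close>

lemma char_sub_annihilated:
  assumes M: "module R M" and z: "z \<in> char_sub G \<chi> M"
  shows "\<exists>e\<in>idem_products \<chi>. e \<odot>\<^bsub>M\<^esub> z = \<zero>\<^bsub>M\<^esub>"
proof -
  interpret M: module R M by fact
  note ec = idem_products_closed
  note ic = subsetD[OF char_ideal_subset[OF comm_G, of \<chi>]]
  let ?S = "{r \<odot>\<^bsub>M\<^esub> x | r x. r \<in> char_ideal G \<chi> \<and> x \<in> carrier M}"
  have S: "?S \<subseteq> carrier M" using ic by auto
  have gen: "\<exists>e\<in>idem_products \<chi>. e \<odot>\<^bsub>M\<^esub> h = \<zero>\<^bsub>M\<^esub>" if h: "h \<in> ?S" for h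
  proof -
    obtain r x where rx: "h = r \<odot>\<^bsub>M\<^esub> x" "r \<in> char_ideal G \<chi>" "x \<in> carrier M" using h by blast
    obtain e where e: "e \<in> idem_products \<chi>" "e \<otimes>\<^bsub>R\<^esub> r = 0"
      using char_ideal_annihilated[OF rx(2)] by blast
    have "e \<odot>\<^bsub>M\<^esub> h = (e \<otimes>\<^bsub>R\<^esub> r) \<odot>\<^bsub>M\<^esub> x"
      using rx ic ec[OF e(1)] by (simp add: M.smult_assoc1)
    also have "\<dots> = \<zero>\<^bsub>M\<^esub>" using M.smult_l_null[OF rx(3)] e(2) by simp
    finally show ?thesis using e(1) by blast
  qed
  from z[unfolded char_sub_def ideal_smult_def] show ?thesis
  proof (induction rule: generate.induct)
    case one
    then show ?case using idem_products.one ec M.smult_r_null by auto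
  next
    case (incl h)
    then show ?case by (rule gen)
  next
    case (inv h)
    then obtain e where e: "e \<in> idem_products \<chi>" "e \<odot>\<^bsub>M\<^esub> h = \<zero>\<^bsub>M\<^esub>" using gen by blast
    moreover have "h \<in> carrier M" using inv S by auto
    ultimately have "e \<odot>\<^bsub>M\<^esub> (\<ominus>\<^bsub>M\<^esub> h) = \<zero>\<^bsub>M\<^esub>" using M.smult_r_minus[OF ec[OF e(1)]] by simp
    then show ?case using e(1) by (auto simp: a_inv_def)
  next
    case (eng h k)
    have hk: "h \<in> carrier M" "k \<in> carrier M"
      using eng M.add.generate_in_carrier[OF S] by auto
    obtain d e where d: "d \<in> idem_products \<chi>" "d \<odot>\<^bsub>M\<^esub> h = \<zero>\<^bsub>M\<^esub>"
      and e: "e \<in> idem_products \<chi>" "e \<odot>\<^bsub>M\<^esub> k = \<zero>\<^bsub>M\<^esub>" using eng.IH by blast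
    have c: "d \<in> carrier R" "e \<in> carrier R" using ec d e by auto
    have "(d \<otimes>\<^bsub>R\<^esub> e) \<odot>\<^bsub>M\<^esub> h = e \<odot>\<^bsub>M\<^esub> (d \<odot>\<^bsub>M\<^esub> h)"
      using c hk by (metis M.smult_assoc1 R.m_comm)
    moreover have "(d \<otimes>\<^bsub>R\<^esub> e) \<odot>\<^bsub>M\<^esub> k = d \<odot>\<^bsub>M\<^esub> (e \<odot>\<^bsub>M\<^esub> k)"
      using c hk by (simp add: M.smult_assoc1)
    ultimately have "(d \<otimes>\<^bsub>R\<^esub> e) \<odot>\<^bsub>M\<^esub> (h \<oplus>\<^bsub>M\<^esub> k) = \<zero>\<^bsub>M\<^esub>"
      using c hk d e by (simp add: M.smult_r_distr)
    then show ?case using idem_products_mult[OF d(1) e(1)] by auto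
  qed
qed

text \<open>If the complementary idempotents send x into H, each factor of e fixes x modulo H, and
  so does e. H is kept general because it will be both M^(chi) and a maximal submodule avoiding an
  element.\<close>

lemma diff_idem_products:
  assumes M: "module R M" and H: "submodule H R M" and x: "x \<in> carrier M"
    and H_idem: "\<And>g. g \<in> carrier G \<Longrightarrow> idem g (- of_int (\<chi> g)) \<odot>\<^bsub>M\<^esub> x \<in> H"
    and e: "e \<in> idem_products \<chi>"
  shows "x \<ominus>\<^bsub>M\<^esub> e \<odot>\<^bsub>M\<^esub> x \<in> H"
proof -
  interpret M: module R M by fact
  interpret H: submodule H R M by fact
  show ?thesis
    using e
  proof induction
    case one
    then show ?case
      using M.smult_one[OF x] x H.one_closed by (simp add: M.r_neg M.minus_eq)
    next
    case (mult e g)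
    let ?a = "idem g (of_int (\<chi> g))" and ?b = "idem g (- of_int (\<chi> g))"
    have c: "?a \<in> carrier R" "?b \<in> carrier R" "e \<in> carrier R"
      using idem_closed[OF mult.hyps(2)] char_values[OF mult.hyps(2)] idem_products_closed[OF mult.hyps(1)]
      by (force intro: idem_closed)+
    have ab: "?a \<oplus>\<^bsub>R\<^esub> ?b = \<one>\<^bsub>R\<^esub>" by (simp add: idem_add)
    have "x = (?a \<oplus>\<^bsub>R\<^esub> ?b) \<odot>\<^bsub>M\<^esub> x" using ab x M.smult_one by metis
    also have "\<dots> = ?a \<odot>\<^bsub>M\<^esub> x \<oplus>\<^bsub>M\<^esub> ?b \<odot>\<^bsub>M\<^esub> x" using c x by (intro M.smult_l_distr)
    finally have x_eq: "x = ?a \<odot>\<^bsub>M\<^esub> x \<oplus>\<^bsub>M\<^esub> ?b \<odot>\<^bsub>M\<^esub> x" .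
    \<comment> \<open>With a + b = 1 one has x - a e x = b x + a (x - e x). The first term lies in H
      by assumption, the second by induction.\<close>
    have "x \<ominus>\<^bsub>M\<^esub> (?a \<otimes>\<^bsub>R\<^esub> e) \<odot>\<^bsub>M\<^esub> x
        = ?b \<odot>\<^bsub>M\<^esub> x \<oplus>\<^bsub>M\<^esub> (?a \<odot>\<^bsub>M\<^esub> x \<ominus>\<^bsub>M\<^esub> ?a \<odot>\<^bsub>M\<^esub> (e \<odot>\<^bsub>M\<^esub> x))"
      apply (subst (1) x_eq)
      using c x by (simp add: M.smult_assoc1 M.minus_eq M.a_ac)
    also have "?a \<odot>\<^bsub>M\<^esub> x \<ominus>\<^bsub>M\<^esub> ?a \<odot>\<^bsub>M\<^esub> (e \<odot>\<^bsub>M\<^esub> x) = ?a \<odot>\<^bsub>M\<^esub> (x \<ominus>\<^bsub>M\<^esub> e \<odot>\<^bsub>M\<^esub> x)"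
      using c x by (simp add: M.minus_eq M.smult_r_distr M.smult_r_minus)
    finally show ?case
      using H.m_closed[OF H_idem[OF mult.hyps(2)] H.smult_closed[OF c(1) mult.IH]] by simp
  qed
qed

text \<open>Products act as the identity modulo M^(chi), because each complementary idempotent is a
  multiple of some g - \<chi>(g). In particular an element killed by a product lies in M^(chi), the
  other half of the description.\<close>

lemma diff_in_char_sub:
  assumes M: "module R M" and x: "x \<in> carrier M" and e: "e \<in> idem_products \<chi>"
  shows "x \<ominus>\<^bsub>M\<^esub> e \<odot>\<^bsub>M\<^esub> x \<in> char_sub G \<chi> M"
proof -
  interpret M: module R M by fact
  show ?thesis
  proof (rule diff_idem_products[OF M submodule_char_sub[OF comm_G M] x _ e])
    fix g assume g: "g \<in> carrier G"
    let ?s = "of_int (\<chi> g) :: rat"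
    let ?r = "Poly_Mapping.single g 1 - Poly_Mapping.single \<one> ?s"
    interpret Z: cring "ZG G" by (rule cring_ZG[OF comm_G])
    have "?r \<in> char_ideal G \<chi>"
      unfolding char_ideal_def
    proof (rule subsetD[OF Z.genideal_self])
      show "{Poly_Mapping.single g 1 - Poly_Mapping.single \<one> (of_int (\<chi> g)) | g. g \<in> carrier G}
          \<subseteq> carrier (ZG G)"
        using generator_closed by blast
    qed (use g in blast)
    moreover have h: "Poly_Mapping.single \<one> (- ?s / 2) \<in> carrier R"
      using char_values[OF g] sign_half[of "- ?s"] by (intro single_in_ZG_half) auto
    moreover have "idem g (- ?s) \<odot>\<^bsub>M\<^esub> x = ?r \<odot>\<^bsub>M\<^esub> (Poly_Mapping.single \<one> (- ?s / 2) \<odot>\<^bsub>M\<^esub> x)"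
      unfolding idem_complement_eq[OF g char_values[OF g]]
      using calculation x char_ideal_subset[OF comm_G] by (intro M.smult_assoc1) auto
    ultimately show "idem g (- ?s) \<odot>\<^bsub>M\<^esub> x \<in> char_sub G \<chi> M"
      unfolding char_sub_def ideal_smult_def using x M.smult_closed by (intro generate.incl) blast
  qed
qed

end

section \<open>Separating an element from a submodule by a character\<close>

lemma maximal_submodule_avoiding:
  assumes M: "module R M" and K: "submodule K R M" and y: "y \<notin> K"
  obtains H where "submodule H R M" "K \<subseteq> H" "y \<notin> H"
    and "\<forall>L. submodule L R M \<longrightarrow> H \<subseteq> L \<longrightarrow> y \<notin> L \<longrightarrow> L = H"
proof -
  interpret M: module R M by fact
  let ?A = "{L. submodule L R M \<and> K \<subseteq> L \<and> y \<notin> L}"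
  have "\<exists>H\<in>?A. \<forall>L\<in>?A. H \<subseteq> L \<longrightarrow> L = H"
  proof (rule subset_Zorn_nonempty)
    show "?A \<noteq> {}" using K y by blast
  next
    fix C assume C: "C \<noteq> {}" "subset.chain ?A C"
    have sm: "submodule L R M" if "L \<in> C" for L using C(2) that by (auto simp: subset.chain_def)
    note sg = submodule.axioms(1)[OF sm]
    have "submodule (\<Union>C) R M"
    proof (rule submodule.intro)
      show "subgroup (\<Union>C) (add_monoid M)"
      proof (rule M.add.subgroupI)
        show "\<Union>C \<subseteq> carrier M" using subgroup.subset[OF sg] by fastforce
        show "\<Union>C \<noteq> {}" using C(1) subgroup.one_closed[OF sg] by fastforce
      next
        fix a assume "a \<in> \<Union>C"
        then show "\<ominus>\<^bsub>M\<^esub> a \<in> \<Union>C" using subgroup.m_inv_closed[OF sg] by (auto simp: a_inv_def)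
      next
        fix a b assume "a \<in> \<Union>C" "b \<in> \<Union>C"
        then obtain S T where ST: "a \<in> S" "S \<in> C" "b \<in> T" "T \<in> C" by blast
        then have "S \<subseteq> T \<or> T \<subseteq> S" using C(2) by (auto simp: subset.chain_def)
        then obtain L where L: "L \<in> C" "a \<in> L" "b \<in> L" using ST by blast
        then show "a \<oplus>\<^bsub>M\<^esub> b \<in> \<Union>C" using subgroup.m_closed[OF sg[OF L(1)], of a b] by auto
      qed
    qed (use submodule.smult_closed[OF sm] in \<open>auto simp: submodule_axioms_def\<close>)
    then show "\<Union>C \<in> ?A" using C by (auto simp: subset.chain_def)
  qed
  then obtain H where "H \<in> ?A" and max: "\<forall>L\<in>?A. H \<subseteq> L \<longrightarrow> L = H" ..
  then have H: "submodule H R M" "K \<subseteq> H" "y \<notin> H" by simp_all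
  show thesis
  proof (rule that[OF H], intro allI impI)
    fix L assume L: "submodule L R M" "H \<subseteq> L" "y \<notin> L"
    then have "L \<in> ?A" using H(2) by simp
    then show "L = H" using max L(2) by simp
  qed
qed

text \<open>Multiplication by a is linear because the group ring is commutative, so the preimage of
  a submodule is a submodule.\<close>

lemma submodule_vimage_smult:
  assumes M: "module R M" and H: "submodule H R M" and a: "a \<in> carrier R"
  shows "submodule {x \<in> carrier M. a \<odot>\<^bsub>M\<^esub> x \<in> H} R M"
proof -
  interpret M: module R M by fact
  interpret H: submodule H R M by fact
  show ?thesis
  proof (rule submodule.intro)
    show "subgroup {x \<in> carrier M. a \<odot>\<^bsub>M\<^esub> x \<in> H} (add_monoid M)"
    proof (rule M.add.subgroupI)
      show "{x \<in> carrier M. a \<odot>\<^bsub>M\<^esub> x \<in> H} \<noteq> {}"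
        using H.one_closed a by (auto intro!: exI[of _ "\<zero>\<^bsub>M\<^esub>"])
    qed (use a H.m_closed H.m_inv_closed in \<open>auto simp: M.smult_r_distr M.smult_r_minus a_inv_def[symmetric]\<close>)
    show "submodule_axioms {x \<in> carrier M. a \<odot>\<^bsub>M\<^esub> x \<in> H} R M"
    proof (rule submodule_axioms.intro)
      fix b x assume b: "b \<in> carrier R" and x: "x \<in> {x \<in> carrier M. a \<odot>\<^bsub>M\<^esub> x \<in> H}"
      have "a \<odot>\<^bsub>M\<^esub> (b \<odot>\<^bsub>M\<^esub> x) = b \<odot>\<^bsub>M\<^esub> (a \<odot>\<^bsub>M\<^esub> x)"
        using a b x by (metis (lifting) M.smult_assoc1 R.m_comm mem_Collect_eq)
      then show "b \<odot>\<^bsub>M\<^esub> x \<in> {x \<in> carrier M. a \<odot>\<^bsub>M\<^esub> x \<in> H}"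
        using x b H.smult_closed by auto
    qed
  qed
qed

text \<open>Modulo K itself an element g need not act on y by a sign. Modulo a maximal H avoiding y
  it does, and these signs form the character; its products then fix y modulo H and cannot send y
  into K.\<close>

lemma separating_character:
  assumes M: "module R M" and K: "submodule K R M" and y: "y \<in> carrier M" "y \<notin> K"
  obtains \<chi> where "\<chi> \<in> hom G sign_img" "\<forall>e\<in>idem_products \<chi>. e \<odot>\<^bsub>M\<^esub> y \<notin> K"
proof -
  interpret M: module R M by fact
  obtain H where H: "submodule H R M" and KH: "K \<subseteq> H" and yH: "y \<notin> H"
    and max: "\<forall>L. submodule L R M \<longrightarrow> H \<subseteq> L \<longrightarrow> y \<notin> L \<longrightarrow> L = H"
    by (rule maximal_submodule_avoiding[OF M K y(2)])
  interpret H: submodule H R M by fact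
  have dich: "idem g (-1) \<odot>\<^bsub>M\<^esub> y \<in> H \<or> idem g 1 \<odot>\<^bsub>M\<^esub> y \<in> H" if g: "g \<in> carrier G" for g
  proof (rule ccontr)
    assume *: "\<not> ?thesis"
    \<comment> \<open>This submodule contains H and, by assumption, not y, so maximality makes it
      equal to H. By orthogonality it contains \<open>idem g 1\<close> applied to y, which was
      assumed to lie outside H.\<close>
    let ?L = "{x \<in> carrier M. idem g (-1) \<odot>\<^bsub>M\<^esub> x \<in> H}"
    have c: "idem g (-1) \<in> carrier R" "idem g 1 \<in> carrier R" using idem_closed g by auto
    have "?L = H"
      using * c y(1) H.smult_closed[OF c(1)] H.subset
      by (intro max[rule_format] submodule_vimage_smult[OF M H c(1)]) auto
    moreover have "idem g (-1) \<odot>\<^bsub>M\<^esub> (idem g 1 \<odot>\<^bsub>M\<^esub> y) = \<zero>\<^bsub>M\<^esub>"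
      using M.smult_assoc1[OF c y(1)] M.smult_l_null[OF y(1)] idem_orthogonal[OF g, of 1] by simp
    then have "idem g 1 \<odot>\<^bsub>M\<^esub> y \<in> ?L"
      using M.smult_closed[OF c(2) y(1)] H.one_closed by simp
    ultimately show False using * by blast
  qed
  \<comment> \<open>The sign is chosen so that the complementary idempotent sends y into H; in the
    \<open>else\<close> case this is what \<open>dich\<close> leaves. On \<open>carrier G\<close>
    the sign is forced: if both idempotents sent y into H, their sum y would lie in H.\<close>
  define \<chi> where "\<chi> g = (if idem g (-1) \<odot>\<^bsub>M\<^esub> y \<in> H then 1 else (-1 :: int))" for g
  have \<chi>_H: "idem g (- of_int (\<chi> g)) \<odot>\<^bsub>M\<^esub> y \<in> H" if "g \<in> carrier G" for g
    using dich[OF that] by (auto simp: \<chi>_def)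
  have vals: "of_int (\<chi> g) \<in> {-1, 1 :: rat}" for g by (simp add: \<chi>_def)
  have "\<chi> (g \<otimes> h) = \<chi> g * \<chi> h" if g: "g \<in> carrier G" and h: "h \<in> carrier G" for g h
  proof (rule ccontr)
    assume "\<not> ?thesis"
    \<comment> \<open>Values are signs, so failure of multiplicativity means the opposite sign. Then
      both idempotents of the product of g and h send y into H, one by \<open>idem_mult\<close> and
      the other by the choice of \<chi>, and their sum gives y in H.\<close>
    then have neq: "\<chi> (g \<otimes> h) = - (\<chi> g * \<chi> h)" by (auto simp: \<chi>_def split: if_splits)
    let ?s = "of_int (\<chi> g) :: rat" and ?t = "of_int (\<chi> h) :: rat"
    have st: "?s * ?t \<in> {-1, 1}" using vals[of g] vals[of h] by auto
    have c: "idem g (- ?s) \<in> carrier R" "idem h (- ?t) \<in> carrier R"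
      "Poly_Mapping.single g ?s \<in> carrier R" "idem (g \<otimes> h) (- (?s * ?t)) \<in> carrier R"
      "idem (g \<otimes> h) (?s * ?t) \<in> carrier R"
      using g h vals[of g] vals[of h] st by (auto intro!: idem_closed single_in_ZG_half)
    have "idem (g \<otimes> h) (- (?s * ?t)) \<odot>\<^bsub>M\<^esub> y
        = idem g (- ?s) \<odot>\<^bsub>M\<^esub> y \<oplus>\<^bsub>M\<^esub> Poly_Mapping.single g ?s \<odot>\<^bsub>M\<^esub> (idem h (- ?t) \<odot>\<^bsub>M\<^esub> y)"
      using M.smult_l_distr[OF c(1) R.m_closed[OF c(3,2)] y(1)] M.smult_assoc1[OF c(3,2) y(1)]
        idem_mult[OF g h vals vals] by simp
    also have "\<dots> \<in> H"
      using H.m_closed[OF \<chi>_H[OF g] H.smult_closed[OF c(3) \<chi>_H[OF h]]] by simp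
    finally have 1: "idem (g \<otimes> h) (- (?s * ?t)) \<odot>\<^bsub>M\<^esub> y \<in> H" .
    have 2: "idem (g \<otimes> h) (?s * ?t) \<odot>\<^bsub>M\<^esub> y \<in> H"
      using \<chi>_H[of "g \<otimes> h"] g h by (simp add: neq)
    have "y = idem (g \<otimes> h) (?s * ?t) \<odot>\<^bsub>M\<^esub> y \<oplus>\<^bsub>M\<^esub> idem (g \<otimes> h) (- (?s * ?t)) \<odot>\<^bsub>M\<^esub> y"
      using M.smult_l_distr[OF c(5,4) y(1)] M.smult_one[OF y(1)] by (simp add: idem_add)
    then show False using H.m_closed[OF 2 1] yH by simp
  qed
  then have hom: "\<chi> \<in> hom G sign_img"
    by (auto simp: hom_def sign_img_def) (simp add: \<chi>_def split: if_splits)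
  moreover have "\<forall>e\<in>idem_products \<chi>. e \<odot>\<^bsub>M\<^esub> y \<notin> K"
  proof (intro ballI notI)
    fix e assume e: "e \<in> idem_products \<chi>"
    assume "e \<odot>\<^bsub>M\<^esub> y \<in> K"
    then have ey: "e \<odot>\<^bsub>M\<^esub> y \<in> H" using KH by blast
    \<comment> \<open>The first summand lies in H by \<open>diff_idem_products\<close>, the second
      because K is contained in H; together they would put y in H.\<close>
    have "y = (y \<ominus>\<^bsub>M\<^esub> e \<odot>\<^bsub>M\<^esub> y) \<oplus>\<^bsub>M\<^esub> e \<odot>\<^bsub>M\<^esub> y"
      using y(1) ey H.subset by (auto simp: M.minus_eq M.a_assoc M.l_neg)
    then show False
      using H.m_closed[OF diff_idem_products[OF hom M H y(1) \<chi>_H e] ey] yH by simp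
  qed
  ultimately show thesis by (rule that)
qed

section \<open>The induced maps in terms of representatives\<close>

lemma carrier_char_quot: "carrier (char_quot G \<chi> M') = {char_sub G \<chi> M' +>\<^bsub>M'\<^esub> x | x. x \<in> carrier M'}"
  by (auto simp: char_quot_def quot_module_def A_RCOSETS_def')

lemma char_sub_abelian_subgroup:
  "module R M' \<Longrightarrow> abelian_subgroup (char_sub G \<chi> M') M'"
  by (rule submodule_additive[OF _ submodule_char_sub[OF comm_G]])

lemma coset_eq_iff:
  "module R M' \<Longrightarrow> x \<in> carrier M' \<Longrightarrow> y \<in> carrier M' \<Longrightarrow>
    char_sub G \<chi> M' +>\<^bsub>M'\<^esub> x = char_sub G \<chi> M' +>\<^bsub>M'\<^esub> y \<longleftrightarrow> x \<ominus>\<^bsub>M'\<^esub> y \<in> char_sub G \<chi> M'"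
  by (rule abelian_subgroup.a_rcos_eq_iff[OF char_sub_abelian_subgroup])

context
  fixes M :: "('a \<Rightarrow>\<^sub>0 rat, 'm, 'd) module_scheme"
    and N :: "('a \<Rightarrow>\<^sub>0 rat, 'n, 'e) module_scheme"
    and f :: "'m \<Rightarrow> 'n"
  assumes M: "module R M" and N: "module R N" and f: "f \<in> mod_hom R M N"
begin

interpretation M: module R M by (fact M)
interpretation N: module R N by (fact N)

lemma f_closed: "x \<in> carrier M \<Longrightarrow> f x \<in> carrier N"
  using f by (auto simp: mod_hom_def hom_def)

lemma f_add: "x \<in> carrier M \<Longrightarrow> y \<in> carrier M \<Longrightarrow> f (x \<oplus>\<^bsub>M\<^esub> y) = f x \<oplus>\<^bsub>N\<^esub> f y"
  using f by (auto simp: mod_hom_def hom_def)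

lemma f_smult: "a \<in> carrier R \<Longrightarrow> x \<in> carrier M \<Longrightarrow> f (a \<odot>\<^bsub>M\<^esub> x) = a \<odot>\<^bsub>N\<^esub> f x"
  using f by (auto simp: mod_hom_def)

interpretation f: group_hom "add_monoid M" "add_monoid N" f
  using f by (intro group_hom.intro group_hom_axioms.intro M.a_group N.a_group) (simp add: mod_hom_def)

lemma f_zero: "f \<zero>\<^bsub>M\<^esub> = \<zero>\<^bsub>N\<^esub>"
  using f.hom_one by simp

lemma f_diff: "x \<in> carrier M \<Longrightarrow> y \<in> carrier M \<Longrightarrow> f (x \<ominus>\<^bsub>M\<^esub> y) = f x \<ominus>\<^bsub>N\<^esub> f y"
  using f.hom_inv[of y] by (simp add: M.minus_eq N.minus_eq f_add flip: a_inv_def)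

lemma inj_iff: "inj_on f (carrier M) \<longleftrightarrow> (\<forall>x\<in>carrier M. f x = \<zero>\<^bsub>N\<^esub> \<longrightarrow> x = \<zero>\<^bsub>M\<^esub>)"
  using f.inj_on_one_iff by auto

lemma submodule_image: "submodule (f ` carrier M) R N"
proof (rule submodule.intro)
  show "subgroup (f ` carrier M) (add_monoid N)" using f.img_is_subgroup by simp
  show "submodule_axioms (f ` carrier M) R N"
    by (rule submodule_axioms.intro) (auto simp: f_smult[symmetric])
qed

lemma submodule_zero: "submodule {\<zero>\<^bsub>M\<^esub>} R M"
  using M.add.triv_subgroup by (auto intro!: submodule.intro submodule_axioms.intro)

lemma char_map_coset': "x \<in> carrier M \<Longrightarrow>
    char_map G \<chi> N f (char_sub G \<chi> M +>\<^bsub>M\<^esub> x) = char_sub G \<chi> N +>\<^bsub>N\<^esub> f x"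
  by (rule char_map_coset[OF comm_G M N f])

text \<open>A coset is zero exactly when its representative lies in \<open>char_sub\<close>, so the
  triviality of the kernel becomes a condition on elements of M, where the idempotents can
  act.\<close>

lemma char_map_inj_iff:
  "inj_on (char_map G \<chi> N f) (carrier (char_quot G \<chi> M)) \<longleftrightarrow>
    (\<forall>x\<in>carrier M. f x \<in> char_sub G \<chi> N \<longrightarrow> x \<in> char_sub G \<chi> M)"
proof
  assume inj: "inj_on (char_map G \<chi> N f) (carrier (char_quot G \<chi> M))"
  show "\<forall>x\<in>carrier M. f x \<in> char_sub G \<chi> N \<longrightarrow> x \<in> char_sub G \<chi> M"
  proof (intro ballI impI)
    fix x assume x: "x \<in> carrier M" and fx: "f x \<in> char_sub G \<chi> N"
    have "char_sub G \<chi> N +>\<^bsub>N\<^esub> f x = char_sub G \<chi> N +>\<^bsub>N\<^esub> f \<zero>\<^bsub>M\<^esub>"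
      using x fx f_closed[OF x] by (simp add: coset_eq_iff[OF N] f_closed f_zero minus_zero_right[OF N.abelian_group_axioms])
    then have "char_sub G \<chi> M +>\<^bsub>M\<^esub> x = char_sub G \<chi> M +>\<^bsub>M\<^esub> \<zero>\<^bsub>M\<^esub>"
      using x by (intro inj_onD[OF inj]) (auto simp: char_map_coset' carrier_char_quot)
    then show "x \<in> char_sub G \<chi> M" using x by (simp add: coset_eq_iff[OF M] minus_zero_right[OF M.abelian_group_axioms])
  qed
next
  assume *: "\<forall>x\<in>carrier M. f x \<in> char_sub G \<chi> N \<longrightarrow> x \<in> char_sub G \<chi> M"
  show "inj_on (char_map G \<chi> N f) (carrier (char_quot G \<chi> M))"
  proof (rule inj_onI)
    fix C D assume "C \<in> carrier (char_quot G \<chi> M)" "D \<in> carrier (char_quot G \<chi> M)"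
      and eq: "char_map G \<chi> N f C = char_map G \<chi> N f D"
    then obtain x y where x: "x \<in> carrier M" "C = char_sub G \<chi> M +>\<^bsub>M\<^esub> x"
      and y: "y \<in> carrier M" "D = char_sub G \<chi> M +>\<^bsub>M\<^esub> y" by (auto simp: carrier_char_quot)
    have "f (x \<ominus>\<^bsub>M\<^esub> y) \<in> char_sub G \<chi> N"
      using eq x y by (simp add: char_map_coset' coset_eq_iff[OF N] f_closed f_diff)
    then show "C = D" using * x y by (simp add: coset_eq_iff[OF M])
  qed
qed

lemma char_map_surj_iff:
  "char_map G \<chi> N f ` carrier (char_quot G \<chi> M) = carrier (char_quot G \<chi> N) \<longleftrightarrow>
    (\<forall>y\<in>carrier N. \<exists>x\<in>carrier M. y \<ominus>\<^bsub>N\<^esub> f x \<in> char_sub G \<chi> N)"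
proof -
  have "char_map G \<chi> N f ` carrier (char_quot G \<chi> M) = {char_sub G \<chi> N +>\<^bsub>N\<^esub> f x | x. x \<in> carrier M}"
    by (force simp: carrier_char_quot char_map_coset')
  also have "\<dots> = carrier (char_quot G \<chi> N) \<longleftrightarrow>
    (\<forall>y\<in>carrier N. \<exists>x\<in>carrier M. char_sub G \<chi> N +>\<^bsub>N\<^esub> y = char_sub G \<chi> N +>\<^bsub>N\<^esub> f x)"
    using f_closed by (auto simp: carrier_char_quot set_eq_iff) blast+
  also have "\<dots> \<longleftrightarrow> (\<forall>y\<in>carrier N. \<exists>x\<in>carrier M. y \<ominus>\<^bsub>N\<^esub> f x \<in> char_sub G \<chi> N)"
    by (simp add: coset_eq_iff[OF N] f_closed)
  finally show ?thesis .
qed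

text \<open>Supplies the linearity that \<open>mod_iso\<close> demands besides bijectivity.\<close>

lemma char_map_mod_hom: "char_map G \<chi> N f \<in> mod_hom R (char_quot G \<chi> M) (char_quot G \<chi> N)"
proof -
  have sum: "(char_sub G \<chi> M' +>\<^bsub>M'\<^esub> x) \<oplus>\<^bsub>char_quot G \<chi> M'\<^esub> (char_sub G \<chi> M' +>\<^bsub>M'\<^esub> y)
      = char_sub G \<chi> M' +>\<^bsub>M'\<^esub> (x \<oplus>\<^bsub>M'\<^esub> y)"
    if "module R M'" "x \<in> carrier M'" "y \<in> carrier M'" for M' :: "('a \<Rightarrow>\<^sub>0 rat, 'x, 'y) module_scheme" and x y
    using abelian_subgroup.a_rcos_sum[OF char_sub_abelian_subgroup] that
    by (simp add: char_quot_def quot_module_def)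
  note smult = quot_module_props(3)[OF _ submodule_char_sub[OF comm_G], folded char_quot_def]
  show ?thesis
    unfolding mod_hom_def hom_def
    by (auto simp: carrier_char_quot char_map_coset' sum[OF M] sum[OF N] smult[OF M M] smult[OF N N]
        f_closed f_add f_smult)
qed

section \<open>Passage between f and the family of induced maps\<close>

lemma inj_iff_char_maps_inj:
  "inj_on f (carrier M) \<longleftrightarrow>
    (\<forall>\<chi>\<in>hom G sign_img. inj_on (char_map G \<chi> N f) (carrier (char_quot G \<chi> M)))"
  unfolding char_map_inj_iff
proof (intro iffI ballI impI)
  fix \<chi> x assume inj: "inj_on f (carrier M)" and \<chi>: "\<chi> \<in> hom G sign_img"
    and x: "x \<in> carrier M" and fx: "f x \<in> char_sub G \<chi> N"
  obtain e where e: "e \<in> idem_products \<chi>" "e \<odot>\<^bsub>N\<^esub> f x = \<zero>\<^bsub>N\<^esub>"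
    using char_sub_annihilated[OF \<chi> N fx] by blast
  note ec = idem_products_closed[OF \<chi> e(1)]
  \<comment> \<open>By linearity f sends e x to e f(x) = 0. Once e x = 0, the element x equals x - e
    x and so lies in M^(chi).\<close>
  have "e \<odot>\<^bsub>M\<^esub> x = \<zero>\<^bsub>M\<^esub>" using inj e(2) ec x by (simp add: inj_iff f_smult)
  then show "x \<in> char_sub G \<chi> M"
    using diff_in_char_sub[OF \<chi> M x e(1)] x
    by (simp add: minus_zero_right[OF M.abelian_group_axioms])
next
  assume *: "\<forall>\<chi>\<in>hom G sign_img. \<forall>x\<in>carrier M. f x \<in> char_sub G \<chi> N \<longrightarrow> x \<in> char_sub G \<chi> M"
  show "inj_on f (carrier M)"
    unfolding inj_iff
  proof (intro ballI impI)
    fix x assume x: "x \<in> carrier M" and fx: "f x = \<zero>\<^bsub>N\<^esub>"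
    show "x = \<zero>\<^bsub>M\<^esub>"
    proof (rule ccontr)
      assume "x \<noteq> \<zero>\<^bsub>M\<^esub>"
      then obtain \<chi> where \<chi>: "\<chi> \<in> hom G sign_img" "\<forall>e\<in>idem_products \<chi>. e \<odot>\<^bsub>M\<^esub> x \<notin> {\<zero>\<^bsub>M\<^esub>}"
        using separating_character[OF M submodule_zero x] by blast
      \<comment> \<open>Since f x = 0 lies in N^(chi), injectivity of the induced map puts x in
        M^(chi). Some product then kills x, against the choice of \<chi>.\<close>
      have "f x \<in> char_sub G \<chi> N"
        using fx additive_subgroup.zero_closed[OF abelian_subgroup.axioms(1)[OF char_sub_abelian_subgroup[OF N]]]
        by simp
      then show False using * \<chi> x char_sub_annihilated[OF \<chi>(1) M] by blast
    qed
  qed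
qed

text \<open>Quotients of a surjective map are surjective, so only the converse uses idempotents: an
  element y outside the image is separated from the image by a character.\<close>

lemma surj_iff_char_maps_surj:
  "f ` carrier M = carrier N \<longleftrightarrow>
    (\<forall>\<chi>\<in>hom G sign_img. char_map G \<chi> N f ` carrier (char_quot G \<chi> M) = carrier (char_quot G \<chi> N))"
  unfolding char_map_surj_iff
proof (intro iffI ballI)
  fix \<chi> y assume surj: "f ` carrier M = carrier N" and y: "y \<in> carrier N"
  then obtain x where x: "x \<in> carrier M" "y = f x" by blast
  then have "y \<ominus>\<^bsub>N\<^esub> f x = \<zero>\<^bsub>N\<^esub>" using y by (simp add: N.minus_eq N.r_neg)
  then show "\<exists>x\<in>carrier M. y \<ominus>\<^bsub>N\<^esub> f x \<in> char_sub G \<chi> N"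
    using x additive_subgroup.zero_closed[OF abelian_subgroup.axioms(1)[OF char_sub_abelian_subgroup[OF N]]]
    by metis
next
  assume *: "\<forall>\<chi>\<in>hom G sign_img. \<forall>y\<in>carrier N. \<exists>x\<in>carrier M. y \<ominus>\<^bsub>N\<^esub> f x \<in> char_sub G \<chi> N"
  have "y \<in> f ` carrier M" if y: "y \<in> carrier N" for y
  proof (rule ccontr)
    assume "y \<notin> f ` carrier M"
    then obtain \<chi> where \<chi>: "\<chi> \<in> hom G sign_img"
      "\<forall>e\<in>idem_products \<chi>. e \<odot>\<^bsub>N\<^esub> y \<notin> f ` carrier M"
      by (rule separating_character[OF N submodule_image y])
    obtain x where x: "x \<in> carrier M" "y \<ominus>\<^bsub>N\<^esub> f x \<in> char_sub G \<chi> N" using * \<chi>(1) y by blast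
    obtain e where e: "e \<in> idem_products \<chi>" "e \<odot>\<^bsub>N\<^esub> (y \<ominus>\<^bsub>N\<^esub> f x) = \<zero>\<^bsub>N\<^esub>"
      using char_sub_annihilated[OF \<chi>(1) N x(2)] by blast
    note ec = idem_products_closed[OF \<chi>(1) e(1)]
    have "e \<odot>\<^bsub>N\<^esub> y \<ominus>\<^bsub>N\<^esub> e \<odot>\<^bsub>N\<^esub> f x = \<zero>\<^bsub>N\<^esub>"
      using e(2) ec y f_closed[OF x(1)] by (simp add: N.minus_eq N.smult_r_distr N.smult_r_minus)
    \<comment> \<open>The product e that kills y - f x sends y to f(e x), an element of the image,
      which the choice of \<chi> excludes.\<close>
    then have "e \<odot>\<^bsub>N\<^esub> y = f (e \<odot>\<^bsub>M\<^esub> x)"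
      using N.minus_equality[of "e \<odot>\<^bsub>N\<^esub> y" "\<ominus>\<^bsub>N\<^esub> (e \<odot>\<^bsub>N\<^esub> f x)"]
        ec y x(1) f_closed[OF x(1)] by (simp add: f_smult N.minus_eq)
    then show False using bspec[OF \<chi>(2) e(1)] ec x(1) by auto
  qed
  then show "f ` carrier M = carrier N" using f_closed by blast
qed

lemma iso_iff_char_maps_iso:
  "f \<in> mod_iso R M N \<longleftrightarrow>
    (\<forall>\<chi>\<in>hom G sign_img. char_map G \<chi> N f \<in> mod_iso R (char_quot G \<chi> M) (char_quot G \<chi> N))"
  by (simp add: mod_iso_def bij_betw_def f char_map_mod_hom inj_iff_char_maps_inj
      surj_iff_char_maps_surj ball_conj_distrib)

end

end

theorem proposition3p10:
  fixes G :: "('g, 'b) monoid_scheme"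
    and M :: "('g \<Rightarrow>\<^sub>0 rat, 'm, 'd) module_scheme"
    and N :: "('g \<Rightarrow>\<^sub>0 rat, 'n, 'e) module_scheme"
    and f :: "'m \<Rightarrow> 'n"
  assumes "comm_group G"
    and "\<forall>g\<in>carrier G. g [^]\<^bsub>G\<^esub> (2::nat) = \<one>\<^bsub>G\<^esub>"
    and "module (ZG_half G) M"
    and "module (ZG_half G) N"
    and "f \<in> mod_hom (ZG_half G) M N"
  shows "(inj_on f (carrier M) \<longleftrightarrow>
           (\<forall>\<chi>\<in>hom G sign_img. inj_on (char_map G \<chi> N f) (carrier (char_quot G \<chi> M))))
       \<and> (f ` carrier M = carrier N \<longleftrightarrow>
           (\<forall>\<chi>\<in>hom G sign_img. char_map G \<chi> N f ` carrier (char_quot G \<chi> M) = carrier (char_quot G \<chi> N)))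
       \<and> (f \<in> mod_iso (ZG_half G) M N \<longleftrightarrow>
           (\<forall>\<chi>\<in>hom G sign_img. char_map G \<chi> N f
              \<in> mod_iso (ZG_half G) (char_quot G \<chi> M) (char_quot G \<chi> N)))"
proof -
  interpret comm_group G by fact
  interpret elementary_2_group G
    using assms(2) by unfold_locales (simp add: numeral_2_eq_2)
  show ?thesis
    by (intro conjI inj_iff_char_maps_inj surj_iff_char_maps_surj iso_iff_char_maps_iso assms(3-5))
qed

end
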